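(* For $\alpha>0$ and $q\ge2$, let $\mathcal{C}\subseteq\mathbb{R}^d$ be a compact $(\alpha,q)$-uniformly convex set of diameter $\delta>0$, let $f\colon\mathcal{C}\to\mathbb{R}$ be a convex and $L$-smooth function with lower-bounded gradients, that is, $\|\nabla f(x)\|_2\ge\lambda$ for all $x\in\mathcal{C}$ for some $\lambda>0$, with unique minimizer $x^*\in\operatorname{argmin}_{x\in\mathcal{C}}f(x)$. Let $T\in\mathbb{N}$ and $\eta_t=\frac{4}{t+4}$ for all $t\in\mathbb{Z}$. Then, for the iterates $x_t$ of the Frank-Wolfe algorithm with step-size $\eta_t$, with $h_t=f(x_t)-f(x^* )$: when $q\ge4$, it holds that $$h_t\le\max\left\{\eta_{t-2}^{1/(1-2/q)}\frac{L\delta^2}{2},\ \left(\eta_{t-2}L\left(\frac{2}{\alpha\lambda}\right)^{2/q}\right)^{1/(1-2/q)}+\eta_{t-2}^2\frac{L\delta^2}{2}\right\}$$ for all $t\in\{1,\ldots,T\}$; and letting $S=\lceil8L\delta^2\rceil$, when $q\in[2,4[$, it holds that $$h_t\le\max\left\{\left(\frac{\eta_{t-2}}{\eta_{S-1}}\right)^2h_S,\ \left(\eta_{t-2}L\left(\frac{2}{\alpha\lambda}\right)^{2/q}\right)^2+\eta_{t-2}^2\frac{L\delta^2}{2}\right\}$$ for all $t\in\{S,\ldots,T\}$.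
   Context: Frank-Wolfe algorithm (FW): given $x_0\in\mathcal{C}$ and step-sizes $\eta_t\in[0,1]$ for $t\in\{0,\ldots,T-1\}$, for $t=0,\ldots,T-1$ choose $p_t\in\operatorname{argmin}_{p\in\mathcal{C}}\langle\nabla f(x_t),p-x_t\rangle$ and set $x_{t+1}=(1-\eta_t)x_t+\eta_tp_t$. $(\alpha,q)$-uniformly convex set: for all $x,y\in\mathcal{C}$, $\gamma\in[0,1]$, and $z\in\mathbb{R}^d$ with $\|z\|_2=1$, it holds that $\gamma x+(1-\gamma)y+\gamma(1-\gamma)\alpha\|x-y\|_2^q\,z\in\mathcal{C}$. $L$-smooth ($L>0$): $f$ is differentiable in an open set containing $\mathcal{C}$ and $f(y)\le f(x)+\langle\nabla f(x),y-x\rangle+\frac{L}{2}\|x-y\|_2^2$ for all $x,y\in\mathcal{C}$. The diameter is with respect to $\|\cdot\|_2$. *)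

theory Defs
  imports "HOL-Analysis.Analysis"
begin

text \<open>
  The gradient as a function. It is meaningful only at points of differentiability, where
  the lemma below justifies the description operator.
\<close>

definition grad :: "('a::real_inner \<Rightarrow> real) \<Rightarrow> 'a \<Rightarrow> 'a" where
  "grad f x = (THE D. GDERIV f x :> D)"

lemma GDERIV_grad:
  fixes f :: "'a::euclidean_space \<Rightarrow> real"
  assumes "f differentiable (at x)"
  shows "GDERIV f x :> grad f x"
proof -
  obtain f' where f': "(f has_derivative f') (at x)"
    using assms unfolding differentiable_def by blast
  then interpret f': bounded_linear f'
    by (rule has_derivative_bounded_linear)
  have "f' = (\<lambda>h. h \<bullet> adjoint f' (1::real))"
    using adjoint_works[OF f'.linear_axioms, of _ "1::real"] by (auto simp: inner_commute)
  with f' have ex: "GDERIV f x :> adjoint f' 1"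
    unfolding gderiv_def by simp
  have "D = adjoint f' 1" if "GDERIV f x :> D" for D
  proof -
    have "(\<lambda>h. h \<bullet> D) = (\<lambda>h. h \<bullet> adjoint f' (1::real))"
      using that ex unfolding gderiv_def by (rule has_derivative_unique)
    then have "h \<bullet> (D - adjoint f' 1) = 0" for h
      by (metis inner_diff_right cancel_comm_monoid_add_class.diff_cancel)
    then show ?thesis
      using inner_eq_zero_iff[of "D - adjoint f' 1"] by simp
  qed
  with ex show ?thesis
    unfolding grad_def by (rule theI)
qed

text \<open>
  \<open>(\<alpha>, q)\<close>-uniform convexity of a set. The exponent \<open>q\<close> is real; \<open>powr\<close> yields
  \<open>0 powr q = 0\<close>, as wanted for \<open>x = y\<close>.
\<close>

definition uniformly_convex_set :: "real \<Rightarrow> real \<Rightarrow> 'a::euclidean_space set \<Rightarrow> bool" where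
  "uniformly_convex_set \<alpha> q C \<longleftrightarrow>
     (\<forall>x\<in>C. \<forall>y\<in>C. \<forall>\<gamma>\<in>{0..1}. \<forall>z. norm z = 1 \<longrightarrow>
        \<gamma> *\<^sub>R x + (1 - \<gamma>) *\<^sub>R y + (\<gamma> * (1 - \<gamma>) * \<alpha> * norm (x - y) powr q) *\<^sub>R z \<in> C)"

text \<open>
  \<open>L\<close>-smoothness over \<open>C\<close>. Since \<open>f\<close> has to be differentiable on a neighbourhood of \<open>C\<close>, it is
  modelled as a total function whose values far away from \<open>C\<close> are irrelevant.
\<close>

definition smooth_over :: "real \<Rightarrow> 'a::euclidean_space set \<Rightarrow> ('a \<Rightarrow> real) \<Rightarrow> bool" where
  "smooth_over L C f \<longleftrightarrow>
     L > 0 \<and>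
     (\<exists>U. open U \<and> C \<subseteq> U \<and> f differentiable_on U) \<and>
     (\<forall>x\<in>C. \<forall>y\<in>C. f y \<le> f x + grad f x \<bullet> (y - x) + L / 2 * (norm (x - y))\<^sup>2)"

text \<open>
  \<open>x\<close> and \<open>p\<close> are the iterates and the vertices of some run of the Frank-Wolfe algorithm with
  \<open>T\<close> steps; ties in the linear minimization are broken arbitrarily. Only
  \<open>x 0, \<dots>, x T\<close> and \<open>p 0, \<dots>, p (T - 1)\<close> are constrained.
\<close>

definition frank_wolfe ::
  "'a::euclidean_space set \<Rightarrow> ('a \<Rightarrow> real) \<Rightarrow> (nat \<Rightarrow> real) \<Rightarrow> nat \<Rightarrow> (nat \<Rightarrow> 'a) \<Rightarrow> (nat \<Rightarrow> 'a) \<Rightarrow> bool"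
where
  "frank_wolfe C f \<eta> T x p \<longleftrightarrow>
     x 0 \<in> C \<and>
     (\<forall>t<T. \<eta> t \<in> {0..1} \<and>
            is_arg_min (\<lambda>v. grad f (x t) \<bullet> (v - x t)) (\<lambda>v. v \<in> C) (p t) \<and>
            x (Suc t) = (1 - \<eta> t) *\<^sub>R x t + \<eta> t *\<^sub>R p t)"

end

theory Submission
  imports Defs
begin

text \<open>
  Write \<open>g\<close> for the Frank-Wolfe gap at \<open>x t\<close> and \<open>d\<close> for the distance from \<open>x t\<close> to \<open>p t\<close>.
  Convexity of \<open>f\<close> gives \<open>h t \<le> g\<close>, uniform convexity of \<open>C\<close> gives \<open>\<alpha> * lam * d powr q \<le> g\<close>, and
  smoothness gives \<open>h (t + 1) \<le> h t - \<eta> * g + \<eta>\<^sup>2 * L / 2 * d\<^sup>2\<close>. If \<open>g\<close> lies above a threshold of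
  order \<open>\<eta> powr e\<close>, half of the linear term absorbs the quadratic one and \<open>h\<close> contracts by the factor
  \<open>1 - \<eta> / 2\<close>; otherwise \<open>h t\<close> itself lies below the threshold. As long as \<open>e \<le> 2\<close>, bounds of order
  \<open>\<eta> powr e\<close> survive the contraction. For \<open>q \<ge> 4\<close> the natural exponent
  \<open>e = 1 / (1 - 2 / q)\<close> is at most 2. For \<open>q < 4\<close> it is not, and \<open>e = 2\<close> works as soon as the
  threshold is at most 1; in the remaining case the standard rate \<open>h t \<le> 8 / 3 * L * \<delta>\<^sup>2 / (t + 4)\<close>
  gives \<open>h t \<le> 1\<close> from \<open>S\<close> on, and there is nothing to prove.
  The argument yields the bounds with \<open>\<eta> (t - 1)\<close> in place of the larger \<open>\<eta> (t - 2)\<close>.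
\<close>

section \<open>Convexity of the objective and of the feasible set\<close>

text \<open>Convexity bounds the difference quotient from \<open>x\<close> towards \<open>y\<close>
  by \<open>f y - f x\<close>; let the increment tend to 0 from the right, the side on which the
  segment stays in \<open>C\<close>.\<close>

lemma convex_on_above_grad:
  fixes f :: "'a::euclidean_space \<Rightarrow> real"
  assumes "convex_on C f" "x \<in> C" "y \<in> C" "f differentiable (at x)"
  shows "f x + grad f x \<bullet> (y - x) \<le> f y"
proof -
  have "(f has_derivative (\<lambda>h. h \<bullet> grad f x)) (at (x + 0 *\<^sub>R (y - x)))"
    using GDERIV_grad[OF assms(4)] by (simp add: gderiv_def)
  moreover have "((\<lambda>s. x + s *\<^sub>R (y - x)) has_derivative (\<lambda>s. s *\<^sub>R (y - x))) (at (0::real))"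
    by (auto intro!: derivative_eq_intros)
  ultimately have "((\<lambda>s. f (x + s *\<^sub>R (y - x))) has_derivative
      (\<lambda>s. (s *\<^sub>R (y - x)) \<bullet> grad f x)) (at (0::real))"
    using has_derivative_compose by fastforce
  then have "((\<lambda>s. f (x + s *\<^sub>R (y - x))) has_real_derivative grad f x \<bullet> (y - x)) (at 0)"
    unfolding has_field_derivative_def by (simp add: inner_commute mult_commute_abs)
  then have "((\<lambda>s. (f (x + s *\<^sub>R (y - x)) - f x) / s) \<longlongrightarrow> grad f x \<bullet> (y - x)) (at_right 0)"
    unfolding DERIV_def by (auto intro: filterlim_mono at_le)
  moreover have "eventually (\<lambda>s. (f (x + s *\<^sub>R (y - x)) - f x) / s \<le> f y - f x) (at_right 0)"
    unfolding eventually_at_right_field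
  proof (intro exI[of _ 1] conjI allI impI)
    fix s :: real assume s: "0 < s" "s < 1"
    have "x + s *\<^sub>R (y - x) = (1 - s) *\<^sub>R x + s *\<^sub>R y"
      by (simp add: algebra_simps)
    then have "f (x + s *\<^sub>R (y - x)) \<le> (1 - s) * f x + s * f y"
      using convex_onD[OF assms(1), of s x y] s assms(2,3) by simp
    then show "(f (x + s *\<^sub>R (y - x)) - f x) / s \<le> f y - f x"
      using s by (simp add: field_simps)
  qed simp
  ultimately have "grad f x \<bullet> (y - x) \<le> f y - f x"
    by (rule tendsto_upperbound) simp
  then show ?thesis by simp
qed

text \<open>Test the minimality of \<open>p\<close> against the point that uniform convexity
  supplies for \<open>z = - G / norm G\<close>. This gives \<open>\<gamma> * (1 - \<gamma>) * N
  \<le> \<gamma> * (G \<bullet> (x - p))\<close> with \<open>N\<close> the left-hand side; divide by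
  \<open>\<gamma>\<close>, the weight of \<open>x\<close>, and let it tend to 0.\<close>

lemma uniformly_convex_set_gap:
  assumes "uniformly_convex_set \<alpha> q C" "x \<in> C" "p \<in> C"
    and min: "\<And>v. v \<in> C \<Longrightarrow> G \<bullet> p \<le> G \<bullet> v"
  shows "\<alpha> * norm G * norm (x - p) powr q \<le> G \<bullet> (x - p)"
proof (cases "G = 0")
  case False
  define N where "N = \<alpha> * norm G * norm (x - p) powr q"
  have "(1 - \<gamma>) * N \<le> G \<bullet> (x - p)" if \<gamma>: "0 < \<gamma>" "\<gamma> < 1" for \<gamma> :: real
  proof -
    let ?z = "- (1 / norm G) *\<^sub>R G"
    have "norm ?z = 1" using False by simp
    moreover have "\<gamma> \<in> {0..1}" using \<gamma> by simp
    ultimately have "\<gamma> *\<^sub>R x + (1 - \<gamma>) *\<^sub>R p + (\<gamma> * (1 - \<gamma>) * \<alpha> * norm (x - p) powr q) *\<^sub>R ?z \<in> C"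
      using assms(1-3) unfolding uniformly_convex_set_def by blast
    from min[OF this]
    have "G \<bullet> p \<le> \<gamma> * (G \<bullet> x) + (1 - \<gamma>) * (G \<bullet> p)
        - (\<gamma> * (1 - \<gamma>) * \<alpha> * norm (x - p) powr q) * ((1 / norm G) * (G \<bullet> G))"
      by (simp add: inner_add_right inner_diff_right)
    also have "(1 / norm G) * (G \<bullet> G) = norm G"
      using False by (simp add: dot_square_norm power2_eq_square)
    finally have "\<gamma> * ((1 - \<gamma>) * N) \<le> \<gamma> * (G \<bullet> (x - p))"
      unfolding N_def by (simp add: algebra_simps)
    then show ?thesis using \<gamma> by simp
  qed
  then have "eventually (\<lambda>\<gamma>. (1 - \<gamma>) * N \<le> G \<bullet> (x - p)) (at_right 0)"
    unfolding eventually_at_right_field by (intro exI[of _ 1]) auto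
  moreover have "((\<lambda>\<gamma>. (1 - \<gamma>) * N) \<longlongrightarrow> (1 - 0) * N) (at_right 0)"
    by (intro tendsto_intros)
  ultimately have "(1 - 0) * N \<le> G \<bullet> (x - p)"
    by (intro tendsto_upperbound) auto
  then show ?thesis by (simp add: N_def)
qed simp

section \<open>Absorbing the quadratic term\<close>

text \<open>Raise \<open>d powr q \<le> g / k\<close> to the power \<open>2 / q\<close>. The factor
  2 is slack that matches the constant of the theorem.\<close>

lemma dist_sq_le_gap_powr:
  fixes d g q k :: real
  assumes "d \<ge> 0" "q > 0" "k > 0" "k * d powr q \<le> g"
  shows "d\<^sup>2 \<le> (2 / k) powr (2 / q) * g powr (2 / q)"
proof -
  have g: "g \<ge> 0"
    using assms by (smt (verit) mult_nonneg_nonneg powr_ge_zero)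
  have "d powr q \<le> 2 / k * g"
    using assms g by (simp add: field_simps)
  then have "(d powr q) powr (2 / q) \<le> (2 / k * g) powr (2 / q)"
    using assms by (intro powr_mono2) auto
  moreover have "(d powr q) powr (2 / q) = d\<^sup>2"
    using assms by (cases "d = 0") (auto simp: powr_powr)
  moreover have "(2 / k * g) powr (2 / q) = (2 / k) powr (2 / q) * g powr (2 / q)"
    by (rule powr_mult)
  ultimately show ?thesis by simp
qed

text \<open>For \<open>K > 0\<close> the threshold is the positive solution of
  \<open>K * g powr r = g\<close>; above it \<open>K \<le> g powr (1 - r)\<close>.\<close>

lemma mult_powr_le_self:
  fixes K g r :: real
  assumes "K \<ge> 0" "r < 1" "g \<ge> K powr (1 / (1 - r))"
  shows "K * g powr r \<le> g"
proof (cases "g = 0")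
  case False
  then have g: "g > 0"
    using assms(3) powr_ge_zero[of K "1 / (1 - r)"] by linarith
  have "(K powr (1 / (1 - r))) powr (1 - r) \<le> g powr (1 - r)"
    using assms by (intro powr_mono2) auto
  then have "K \<le> g powr (1 - r)"
    using assms by (cases "K = 0") (auto simp: powr_powr)
  then have "K * g powr r \<le> g powr (1 - r) * g powr r"
    by (rule mult_right_mono) simp
  then show ?thesis
    using g by (simp flip: powr_add)
qed simp

text \<open>For \<open>1 / 2 \<le> r < 1\<close> the exponent \<open>1 / (1 - r)\<close> is at least
  2, so \<open>K \<le> 1\<close> makes \<open>K\<^sup>2\<close> the larger threshold. The case
  \<open>r = 1\<close>, that is \<open>q = 2\<close>, has no such exponent but is covered
  too.\<close>

lemma mult_powr_le_self_sq:
  fixes K g r :: real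
  assumes "0 < K" "K \<le> 1" "1 / 2 \<le> r" "r \<le> 1" "g \<ge> K\<^sup>2"
  shows "K * g powr r \<le> g"
proof -
  have g: "g > 0" using assms by (smt (verit) zero_less_power)
  have "K \<le> g powr (1 - r)"
  \<comment> \<open>Lowering the exponent from \<open>1 / 2\<close> to \<open>1 - r\<close> helps
    only for \<open>g \<le> 1\<close>; for larger \<open>g\<close> the power is at least 1.\<close>
  proof (cases "g \<le> 1")
    case True
    have "K = (K\<^sup>2) powr (1 / 2)" using assms by (simp add: powr_half_sqrt)
    also have "\<dots> \<le> g powr (1 / 2)" using assms by (intro powr_mono2) auto
    also have "\<dots> \<le> g powr (1 - r)" using assms g True by (intro powr_mono') auto
    finally show ?thesis .
  next
    case False
    then have "1 \<le> g powr (1 - r)" using assms by (intro ge_one_powr_ge_zero) auto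
    then show ?thesis using assms by linarith
  qed
  then have "K * g powr r \<le> g powr (1 - r) * g powr r"
    by (rule mult_right_mono) simp
  then show ?thesis
    using g by (simp flip: powr_add)
qed

text \<open>The squared distance \<open>D\<close> has two bounds: the one through \<open>g\<close>
  serves large gaps, the diameter serves small ones. \<open>absorb\<close> stays abstract because
  the two ranges of \<open>q\<close> use different thresholds \<open>a\<close>.\<close>

lemma gap_step_dichotomy:
  fixes \<eta> g h :: real
  assumes "0 \<le> \<eta>" "0 \<le> L" "0 \<le> h" "h \<le> g"
    and step: "h' \<le> h - \<eta> * g + \<eta>\<^sup>2 * (L / 2 * D)"
    and "D \<le> \<delta>\<^sup>2" "D \<le> M * g powr r"
    and absorb: "g \<ge> a \<Longrightarrow> (\<eta> * L * M) * g powr r \<le> g"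
  shows "h' \<le> (1 - \<eta> / 2) * h \<or> h' \<le> a + \<eta>\<^sup>2 * (L * \<delta>\<^sup>2 / 2)"
proof (cases "g \<ge> a")
  case True
  have "\<eta> * L * D \<le> \<eta> * L * (M * g powr r)"
    using assms by (intro mult_left_mono) auto
  also have "\<dots> \<le> g" using absorb[OF True] by (simp add: mult.assoc)
  finally have "\<eta> / 2 * (\<eta> * L * D) \<le> \<eta> / 2 * g"
    using assms by (intro mult_left_mono) auto
  moreover have "\<eta> / 2 * h \<le> \<eta> / 2 * g"
    using assms by (intro mult_left_mono) auto
  ultimately show ?thesis
    using step by (simp add: algebra_simps power2_eq_square)
next
  case False
  have "\<eta>\<^sup>2 * (L / 2 * D) \<le> \<eta>\<^sup>2 * (L / 2 * \<delta>\<^sup>2)"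
    using assms by (intro mult_left_mono) auto
  moreover have "0 \<le> \<eta> * g" using assms by simp
  ultimately show ?thesis
    using step False assms(4) by (simp add: algebra_simps)
qed

section \<open>Solving the recursions\<close>

text \<open>The factor is \<open>(t + 2) / (t + 4)\<close>, and
  \<open>(t + 2) * (t + 4) \<le> (t + 3)\<^sup>2\<close>. As \<open>(t + 3) / (t + 4)\<close> is
  below 1, replacing the exponent 2 by \<open>e \<le> 2\<close> only enlarges its power.\<close>

lemma contraction_step_powr:
  fixes t e :: real
  assumes "t \<ge> 0" "e \<le> 2"
  shows "(1 - 4 / (t + 4) / 2) * (4 / (t + 3)) powr e \<le> (4 / (t + 4)) powr e"
proof -
  have "1 - 4 / (t + 4) / 2 \<le> ((t + 3) / (t + 4))\<^sup>2"
    using assms by (simp add: divide_simps power2_eq_square) (simp add: algebra_simps)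
  also have "\<dots> = ((t + 3) / (t + 4)) powr 2"
    using assms by simp
  also have "\<dots> \<le> ((t + 3) / (t + 4)) powr e"
    using assms by (intro powr_mono') auto
  finally have "(1 - 4 / (t + 4) / 2) * (4 / (t + 3)) powr e
      \<le> ((t + 3) / (t + 4)) powr e * (4 / (t + 3)) powr e"
    by (rule mult_right_mono) simp
  also have "\<dots> = ((t + 3) / (t + 4) * (4 / (t + 3))) powr e"
    using assms by (simp add: powr_mult[symmetric])
  also have "(t + 3) / (t + 4) * (4 / (t + 3)) = 4 / (t + 4)"
    using assms by (simp add: divide_simps)
  finally show ?thesis .
qed

text \<open>Contraction carries both branches of the maximum from \<open>t\<close> to
  \<open>Suc t\<close>; the other alternative is the second branch itself. Here
  \<open>4 / (real t + 3)\<close> is the step size that produced \<open>h t\<close>.\<close>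

lemma contraction_rate:
  fixes h :: "nat \<Rightarrow> real" and e :: real
  assumes "t0 \<le> t" "t \<le> T" "e \<le> 2" "0 \<le> a" "0 \<le> k" "0 \<le> c"
    and start: "h t0 \<le> a * (4 / (real t0 + 3)) powr e"
    and step: "\<And>t. t0 \<le> t \<Longrightarrow> t < T \<Longrightarrow>
      h (Suc t) \<le> (1 - 4 / (real t + 4) / 2) * h t \<or>
      h (Suc t) \<le> k * (4 / (real t + 4)) powr e + c * (4 / (real t + 4))\<^sup>2"
  shows "h t \<le> max (a * (4 / (real t + 3)) powr e)
                  (k * (4 / (real t + 3)) powr e + c * (4 / (real t + 3))\<^sup>2)"
  using assms(1,2)
proof (induction t rule: dec_induct)
  case base
  then show ?case using start by simp
next
  case (step t)
  let ?m = "1 - 4 / (real t + 4) / 2"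
  let ?u = "4 / (real t + 3)" and ?v = "4 / (real t + 4)"
  have m: "?m \<ge> 0" by (simp add: field_simps)
  have suc: "4 / (real (Suc t) + 3) = ?v" by simp
  have e: "?m * ?u powr e \<le> ?v powr e"
    using contraction_step_powr[of "real t" e] assms(3) by simp
  have two: "?m * ?u\<^sup>2 \<le> ?v\<^sup>2"
    using contraction_step_powr[of "real t" 2] by simp
  from assms(8)[of t] step.hyps step.prems
  consider "h (Suc t) \<le> ?m * h t" | "h (Suc t) \<le> k * ?v powr e + c * ?v\<^sup>2"
    by linarith
  then show ?case
  proof cases
    case 1
    have "h t \<le> max (a * ?u powr e) (k * ?u powr e + c * ?u\<^sup>2)"
      using step by simp
    then have "?m * h t \<le> max (?m * (a * ?u powr e)) (?m * (k * ?u powr e + c * ?u\<^sup>2))"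
      using m by (metis max_mult_distrib_left mult_left_mono)
    moreover have "?m * (a * ?u powr e) \<le> a * ?v powr e"
      using mult_left_mono[OF e assms(4)] by (simp add: mult.left_commute)
    moreover have "?m * (k * ?u powr e + c * ?u\<^sup>2) \<le> k * ?v powr e + c * ?v\<^sup>2"
      using mult_left_mono[OF e assms(5)] mult_left_mono[OF two assms(6)]
      unfolding distrib_left by (simp only: mult.left_commute[of ?m] add_mono)
    ultimately show ?thesis
      using 1 unfolding suc by (smt (verit))
  next
    case 2
    then show ?thesis unfolding suc by simp
  qed
qed

text \<open>From \<open>c / (t + 4)\<close> the step leads to
  \<open>(c * t + 8 * B) / (t + 4)\<^sup>2\<close>. With \<open>c = 8 / 3 * B\<close> the numerator
  is \<open>c * (t + 3)\<close>, and \<open>(t + 3) * (t + 5) \<le> (t + 4)\<^sup>2\<close> closes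
  the induction.\<close>

lemma frank_wolfe_standard_rate:
  fixes h :: "nat \<Rightarrow> real"
  assumes "1 \<le> t" "t \<le> T" "0 \<le> B"
    and step: "\<And>t. t < T \<Longrightarrow>
      h (Suc t) \<le> (1 - 4 / (real t + 4)) * h t + (4 / (real t + 4))\<^sup>2 * (B / 2)"
  shows "h t \<le> 8 / 3 * B / (real t + 4)"
  using assms(1,2)
proof (induction t rule: dec_induct)
  case base
  \<comment> \<open>The first step has size 1 and erases \<open>h 0\<close>, so
    \<open>h 1 \<le> B / 2 \<le> 8 / 15 * B\<close>.\<close>
  then show ?case using step[of 0] assms(3) by simp
next
  case (step t)
  have c: "1 - 4 / (real t + 4) \<ge> 0" by (simp add: field_simps)
  have "h (Suc t) \<le> (1 - 4 / (real t + 4)) * h t + (4 / (real t + 4))\<^sup>2 * (B / 2)"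
    using assms(4) step by simp
  also have "\<dots> \<le> (1 - 4 / (real t + 4)) * (8 / 3 * B / (real t + 4)) + (4 / (real t + 4))\<^sup>2 * (B / 2)"
    using step c by (intro add_right_mono mult_left_mono) auto
  also have "\<dots> = 8 / 3 * B * ((real t + 3) / (real t + 4)\<^sup>2)"
    by (simp add: divide_simps power2_eq_square) (simp add: algebra_simps)
  also have "\<dots> \<le> 8 / 3 * B * (1 / (real (Suc t) + 4))"
    using assms(3) by (intro mult_left_mono)
      (auto simp: divide_simps power2_eq_square, auto simp: algebra_simps)
  finally show ?case by simp
qed

section \<open>Feasibility of the iterates and the two rates\<close>

lemma frank_wolfe_in_set:
  assumes "frank_wolfe C f \<eta> T x p" "convex C" "t \<le> T"
  shows "x t \<in> C"
  using assms(3)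
proof (induction t)
  case (Suc t)
  then show ?case
    using assms(1,2) unfolding frank_wolfe_def is_arg_min_linorder
    by (auto intro: convexD_alt)
qed (use assms(1) in \<open>simp add: frank_wolfe_def\<close>)

theorem theorem3p10:
  fixes \<alpha> q \<delta> L lam :: real
    and C :: "(real ^ 'd) set"
    and f :: "real ^ 'd \<Rightarrow> real"
    and xstar :: "real ^ 'd"
    and T :: nat
    and \<eta> :: "int \<Rightarrow> real"
    and x p :: "nat \<Rightarrow> real ^ 'd"
    and h :: "nat \<Rightarrow> real"
  assumes "\<alpha> > 0" and "q \<ge> 2"
    and "compact C" and "uniformly_convex_set \<alpha> q C"
    and "diameter C = \<delta>" and "\<delta> > 0"
    and "convex_on C f" and "smooth_over L C f"
    and "lam > 0" and "\<forall>y\<in>C. norm (grad f y) \<ge> lam"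
    and "{y. is_arg_min f (\<lambda>y. y \<in> C) y} = {xstar}"
    and "\<forall>t. \<eta> t = 4 / (real_of_int t + 4)"
    and "frank_wolfe C f (\<lambda>t. \<eta> (int t)) T x p"
    and "\<forall>t. h t = f (x t) - f xstar"
  shows "(q \<ge> 4 \<longrightarrow>
           (\<forall>t\<in>{1..T}.
              h t \<le> max (\<eta> (int t - 2) powr (1 / (1 - 2 / q)) * (L * \<delta>\<^sup>2 / 2))
                        ((\<eta> (int t - 2) * L * (2 / (\<alpha> * lam)) powr (2 / q)) powr (1 / (1 - 2 / q))
                          + (\<eta> (int t - 2))\<^sup>2 * (L * \<delta>\<^sup>2 / 2)))) \<and>
         (let S = nat \<lceil>8 * L * \<delta>\<^sup>2\<rceil> in
           q < 4 \<longrightarrow>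
           (\<forall>t\<in>{S..T}.
              h t \<le> max ((\<eta> (int t - 2) / \<eta> (int S - 1))\<^sup>2 * h S)
                        ((\<eta> (int t - 2) * L * (2 / (\<alpha> * lam)) powr (2 / q))\<^sup>2
                          + (\<eta> (int t - 2))\<^sup>2 * (L * \<delta>\<^sup>2 / 2))))"
proof -
  define \<delta>2 where "\<delta>2 = \<delta>\<^sup>2"
  define M where "M = (2 / (\<alpha> * lam)) powr (2 / q)"
  define s where "s t = 4 / (real t + 4)" for t
  define G where "G t = grad f (x t)" for t
  define g where "g t = G t \<bullet> (x t - p t)" for t
  define D where "D t = (norm (x t - p t))\<^sup>2" for t
  have L: "L > 0" and sm: "\<And>u v. u \<in> C \<Longrightarrow> v \<in> C \<Longrightarrow>
      f v \<le> f u + grad f u \<bullet> (v - u) + L / 2 * (norm (u - v))\<^sup>2"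
    using assms(8) unfolding smooth_over_def by auto
  have diff: "f differentiable (at u)" if "u \<in> C" for u
    using assms(8) that unfolding smooth_over_def
    by (metis subsetD differentiable_on_def at_within_open)
  have xstar: "xstar \<in> C" "\<And>v. v \<in> C \<Longrightarrow> f xstar \<le> f v"
    using assms(11) by (auto simp: is_arg_min_linorder set_eq_iff)
  have cvx: "convex C" using assms(7) by (rule convex_on_imp_convex)
  have xC: "x t \<in> C" if "t \<le> T" for t
    using frank_wolfe_in_set[OF assms(13) cvx that] .
  have hn: "0 \<le> h t" if "t \<le> T" for t
    using xstar xC[OF that] assms(14) by simp
  have Mpos: "M > 0" using assms(1,9) by (simp add: M_def)
  have sl: "0 < s t" "s t \<le> 1" for t by (simp_all add: s_def)
  have run: "p t \<in> C" "x (Suc t) = (1 - s t) *\<^sub>R x t + s t *\<^sub>R p t"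
    "\<And>v. v \<in> C \<Longrightarrow> G t \<bullet> p t \<le> G t \<bullet> v" if "t < T" for t
    using assms(12,13) that unfolding frank_wolfe_def is_arg_min_linorder
    by (auto simp: s_def G_def inner_diff_right)
  have hg: "h t \<le> g t" if "t < T" for t
  proof -
    have "f (x t) + G t \<bullet> (xstar - x t) \<le> f xstar"
      unfolding G_def using that xC xstar diff by (intro convex_on_above_grad[OF assms(7)]) auto
    then show ?thesis
      using run(3)[OF that xstar(1)] assms(14) by (simp add: g_def inner_diff_right)
  qed
  have D\<delta>: "D t \<le> \<delta>2" if "t < T" for t
    using diameter_bounded_bound[of C "x t" "p t"] compact_imp_bounded[OF assms(3)]
      xC[of t] run(1)[OF that] that assms(5)
    by (auto simp: D_def \<delta>2_def dist_norm intro: power_mono)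
  \<comment> \<open>The lower bound on the gradient norm enters here and makes the factor
    \<open>\<alpha> * lam\<close> uniform in \<open>t\<close>.\<close>
  have Dg: "D t \<le> M * g t powr (2 / q)" if "t < T" for t
  proof -
    have "\<alpha> * lam * norm (x t - p t) powr q \<le> \<alpha> * norm (G t) * norm (x t - p t) powr q"
      using assms(1,10) xC[of t] that by (intro mult_right_mono mult_left_mono) (auto simp: G_def)
    also have "\<dots> \<le> g t"
      unfolding g_def using that xC run by (intro uniformly_convex_set_gap[OF assms(4)]) auto
    finally show ?thesis
      unfolding D_def M_def using assms(1,2,9) by (intro dist_sq_le_gap_powr) auto
  qed
  have step: "h (Suc t) \<le> h t - s t * g t + (s t)\<^sup>2 * (L / 2 * D t)" if "t < T" for t
  proof -
    have d: "x (Suc t) - x t = - (s t *\<^sub>R (x t - p t))"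
      using run(2)[OF that] by (simp add: algebra_simps)
    then have n: "(norm (x t - x (Suc t)))\<^sup>2 = (s t)\<^sup>2 * D t"
      by (subst norm_minus_commute) (simp add: D_def power_mult_distrib)
    have "f (x (Suc t)) \<le> f (x t) + G t \<bullet> (x (Suc t) - x t) + L / 2 * (norm (x t - x (Suc t)))\<^sup>2"
      unfolding G_def using sm xC that by simp
    then show ?thesis
      unfolding n d using assms(14)[rule_format, of t] assms(14)[rule_format, of "Suc t"]
      by (simp add: g_def algebra_simps)
  qed
  \<comment> \<open>The classical progress bound, used for the start at \<open>t = 1\<close> and for
    the standard rate.\<close>
  have rough: "h (Suc t) \<le> (1 - s t) * h t + (s t)\<^sup>2 * (L * \<delta>2 / 2)" if "t < T" for t
  proof -
    have "s t * h t \<le> s t * g t"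
      using hg[OF that] sl[of t] by (intro mult_left_mono) auto
    moreover have "(s t)\<^sup>2 * (L / 2 * D t) \<le> (s t)\<^sup>2 * (L / 2 * \<delta>2)"
      using D\<delta>[OF that] L by (intro mult_left_mono) auto
    ultimately show ?thesis
      using step[OF that] by (simp add: algebra_simps)
  qed
  have dich: "h (Suc t) \<le> (1 - s t / 2) * h t \<or> h (Suc t) \<le> a + (s t)\<^sup>2 * (L * \<delta>2 / 2)"
    if "t < T" "g t \<ge> a \<Longrightarrow> (s t * L * M) * g t powr (2 / q) \<le> g t" for a t
    unfolding \<delta>2_def
    by (rule gap_step_dichotomy[where g = "g t" and D = "D t" and M = M and r = "2 / q"])
      (use that sl[of t] L hn[of t] hg[of t] step[of t] D\<delta>[of t] Dg[of t] in \<open>auto simp: \<delta>2_def\<close>)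
  \<comment> \<open>The index lives in \<open>int\<close>: at \<open>t = 1\<close> the value is
    \<open>\<eta> (- 1) = 4 / 3\<close>, whereas subtraction in \<open>nat\<close> would
    truncate.\<close>
  have \<eta>2: "\<eta> (int t - 2) = 4 / (real t + 2)" for t
    using assms(12) by simp
  have shift: "0 < 4 / (real t + 3)" "4 / (real t + 3) \<le> 4 / (real t + 2)" for t
    by (simp_all add: field_simps)
  have B: "0 < \<delta>2" "0 < L * \<delta>2" using L assms(6) by (simp_all add: \<delta>2_def)

  \<comment> \<open>The case of large \<open>q\<close>\<close>
  have part1: "h t \<le> max (\<eta> (int t - 2) powr e * (L * \<delta>2 / 2))
      ((\<eta> (int t - 2) * L * M) powr e + (\<eta> (int t - 2))\<^sup>2 * (L * \<delta>2 / 2))"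
    if q: "4 \<le> q" and e_def: "e = 1 / (1 - 2 / q)" and t: "1 \<le> t" "t \<le> T" for t e
  proof -
    \<comment> \<open>For \<open>q > 2\<close>, \<open>e = q / (q - 2)\<close> is at most 2 exactly
      when \<open>q \<ge> 4\<close>.\<close>
    have e: "0 \<le> e" "e \<le> 2" using q by (auto simp: e_def field_simps)
    let ?u = "4 / (real t + 3)" and ?w = "4 / (real t + 2)"
    have "h t \<le> max (L * \<delta>2 / 2 * ?u powr e) ((L * M) powr e * ?u powr e + L * \<delta>2 / 2 * ?u\<^sup>2)"
    proof (rule contraction_rate[OF t e(2)])
      show "h 1 \<le> L * \<delta>2 / 2 * (4 / (real 1 + 3)) powr e"
        using rough[of 0] t by (simp add: s_def)
      fix t assume t: "t < T"
      have "h (Suc t) \<le> (1 - s t / 2) * h t \<or>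
          h (Suc t) \<le> (s t * L * M) powr e + (s t)\<^sup>2 * (L * \<delta>2 / 2)"
        unfolding e_def using t q sl[of t] L Mpos by (intro dich mult_powr_le_self) auto
      moreover have "(s t * L * M) powr e = (L * M) powr e * s t powr e"
        using sl[of t] L Mpos by (simp add: powr_mult mult.assoc)
      ultimately show "h (Suc t) \<le> (1 - 4 / (real t + 4) / 2) * h t \<or>
          h (Suc t) \<le> (L * M) powr e * (4 / (real t + 4)) powr e + L * \<delta>2 / 2 * (4 / (real t + 4))\<^sup>2"
        by (simp add: s_def mult.commute)
    qed (use B in auto)
    also have "\<dots> \<le> max (L * \<delta>2 / 2 * ?w powr e) ((L * M) powr e * ?w powr e + L * \<delta>2 / 2 * ?w\<^sup>2)"
      using shift[of t] e B
      by (intro max.mono add_mono mult_left_mono powr_mono2 power_mono) auto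
    also have "(L * M) powr e * ?w powr e = (?w * L * M) powr e"
      by (simp only: powr_mult mult_ac)
    finally show ?thesis unfolding \<eta>2 by (simp only: mult.commute)
  qed

  \<comment> \<open>The case of small \<open>q\<close>\<close>
  define S where "S = nat \<lceil>8 * L * \<delta>2\<rceil>"
  have part2: "h t \<le> max ((\<eta> (int t - 2) / \<eta> (int S - 1))\<^sup>2 * h S)
      ((\<eta> (int t - 2) * L * M)\<^sup>2 + (\<eta> (int t - 2))\<^sup>2 * (L * \<delta>2 / 2))"
    if q: "q < 4" and t: "S \<le> t" "t \<le> T" for t
  proof -
    have S: "8 * (L * \<delta>2) \<le> real S" "1 \<le> S"
      using B unfolding S_def by (auto simp: mult.assoc) linarith+
    \<comment> \<open>The choice of \<open>S\<close> gives
      \<open>8 / 3 * (L * \<delta>2) \<le> real S / 3\<close>, which pushes the standard rate below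
      1.\<close>
    have small: "h t \<le> 1" if "S \<le> t" "t \<le> T" for t
    proof -
      have "h t \<le> 8 / 3 * (L * \<delta>2) / (real t + 4)"
        using S that rough B by (intro frank_wolfe_standard_rate[where T = T]) (auto simp: s_def)
      also have "\<dots> \<le> 1"
        using S that B by (simp add: field_simps)
      finally show ?thesis .
    qed
    have \<eta>S: "\<eta> (int S - 1) = 4 / (real S + 3)" using assms(12) by simp
    \<comment> \<open>\<open>?a\<close> makes the starting condition at \<open>S\<close> an
      equality.\<close>
    let ?u = "4 / (real t + 3)" and ?w = "4 / (real t + 2)" and ?a = "h S / (4 / (real S + 3))\<^sup>2"
    have hS: "0 \<le> h S" using hn t by simp
    have "h t \<le> max (?a * ?u powr 2) ((L * M)\<^sup>2 * ?u powr 2 + L * \<delta>2 / 2 * ?u\<^sup>2)"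
    proof (rule contraction_rate[OF t])
      show "h S \<le> ?a * (4 / (real S + 3)) powr 2"
        by simp
      fix t assume t: "S \<le> t" "t < T"
      have "h (Suc t) \<le> (1 - s t / 2) * h t \<or>
          h (Suc t) \<le> (s t * L * M)\<^sup>2 + (s t)\<^sup>2 * (L * \<delta>2 / 2)"
      proof (cases "s t * L * M \<le> 1")
        case True
        have "0 < s t * L * M" using sl[of t] L Mpos by simp
        then show ?thesis
          using t q assms(2) True
          by (intro dich mult_powr_le_self_sq) (auto simp: field_simps)
      next
        case False
        then have "1 \<le> (s t * L * M)\<^sup>2" by (simp add: one_le_power)
        moreover have "h (Suc t) \<le> 1" using small t by simp
        moreover have "0 \<le> (s t)\<^sup>2 * (L * \<delta>2 / 2)" using B by simp
        ultimately show ?thesis by linarith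
      qed
      moreover have "(s t * L * M)\<^sup>2 = (L * M)\<^sup>2 * (s t)\<^sup>2"
        by (simp only: power_mult_distrib mult_ac)
      ultimately show "h (Suc t) \<le> (1 - 4 / (real t + 4) / 2) * h t \<or>
          h (Suc t) \<le> (L * M)\<^sup>2 * (4 / (real t + 4)) powr 2 + L * \<delta>2 / 2 * (4 / (real t + 4))\<^sup>2"
        by (simp add: s_def mult.commute)
    qed (use B hS in auto)
    also have "\<dots> \<le> max (?a * ?w powr 2) ((L * M)\<^sup>2 * ?w powr 2 + L * \<delta>2 / 2 * ?w\<^sup>2)"
      using shift[of t] B hS
      by (intro max.mono add_mono mult_left_mono powr_mono2 power_mono) auto
    also have "?w powr 2 = ?w\<^sup>2" by simp
    also have "?a * ?w\<^sup>2 = (?w / (4 / (real S + 3)))\<^sup>2 * h S"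
      by (simp only: power_divide[of ?w] times_divide_eq_left times_divide_eq_right mult.commute)
    also have "(L * M)\<^sup>2 * ?w\<^sup>2 = (?w * L * M)\<^sup>2"
      by (simp only: power_mult_distrib mult_ac)
    finally show ?thesis unfolding \<eta>2 \<eta>S by (simp only: mult.commute)
  qed
  show ?thesis
    using part1 part2 unfolding \<delta>2_def M_def S_def Let_def by auto
qed

end
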